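(* Let $R>0$, $\kappa>0$, let $\mathcal{S}=\{(x,y)\in\mathbb{R}^2: x^2+y^2\le R^2\}$, and for users $k,k'$ with far-field channel responses $h_k,h_{k'}$ let $\Sigma^{\mathcal{S}}_{kk'}=\iint_{(x,y)\in\mathcal{S}}h_k^*(x,y)h_{k'}(x,y)\,dx\,dy$. When $k'=k$, the effective channel (the array gain) equals $$\Sigma^{\mathcal{S}}_{kk}=\pi R^2 .$$
   Context: $j$ is the imaginary unit and $^*$ denotes complex conjugation. A circular surface of radius $R$ lies in the $xy$-plane, centered at the origin. User $k$ ($k=1,\dots,K$) is at $(x_k,y_k,z_k)\in\mathbb{R}^3$ with $z_k>0$, and $d_k^c=\sqrt{x_k^2+y_k^2+z_k^2}$. $\kappa=2\pi/\lambda$ with $\lambda>0$ the wavelength; $\varphi_k\in[-\pi,\pi]$ is a (random) phase of user $k$. In the far-field (plane-wave) model the channel response of user $k$ at the point $(x,y,0)$ is $$h_k(x,y)=\exp\!\Big(-j\Big(\kappa d_k^c+\kappa\,\frac{y_k\,y-x_k\,x}{d_k^c}+\varphi_k\Big)\Big).$$ The array gain of user $k$ is the effective channel $\Sigma^{\mathcal{S}}_{kk}$. *)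

theory Defs
  imports "HOL-Analysis.Analysis"
begin

definition user_distance :: "real \<Rightarrow> real \<Rightarrow> real \<Rightarrow> real" where
  "user_distance xk yk zk = sqrt (xk\<^sup>2 + yk\<^sup>2 + zk\<^sup>2)"

text \<open>Far-field (plane-wave) response at the surface point \<open>(x, y, 0)\<close> of a user at
  \<open>(xk, yk, zk)\<close> with (realized) phase \<open>phik\<close>.\<close>

definition far_field_response ::
  "real \<Rightarrow> real \<Rightarrow> real \<Rightarrow> real \<Rightarrow> real \<Rightarrow> real \<Rightarrow> real \<Rightarrow> complex" where
  "far_field_response kappa xk yk zk phik x y =
    (let d = user_distance xk yk zk in
      exp (- \<i> * complex_of_real (kappa * d + kappa * ((yk * y - xk * x) / d) + phik)))"

definition circular_surface :: "real \<Rightarrow> (real \<times> real) set" where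
  "circular_surface R = {(x, y). x\<^sup>2 + y\<^sup>2 \<le> R\<^sup>2}"

text \<open>The double integral is the Lebesgue integral over a subset of the plane; \<open>h k x y\<close> is the
  response of user \<open>k\<close> at \<open>(x, y, 0)\<close>.\<close>

definition effective_channel ::
  "(real \<times> real) set \<Rightarrow> (nat \<Rightarrow> real \<Rightarrow> real \<Rightarrow> complex) \<Rightarrow> nat \<Rightarrow> nat \<Rightarrow> complex" where
  "effective_channel S h k k' = (LINT (x, y):S|lborel. cnj (h k x y) * h k' x y)"

end

theory Submission
  imports Defs
begin

text \<open>The response is a pure phase, so \<open>cnj h * h\<close> is the constant 1 and the
  user's position and phase drop out. The array gain is therefore the area of the surface.
  \<open>circular_surface_eq_cball\<close> identifies that surface with a Euclidean ball of the
  plane, whose volume is known.\<close>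

lemma cnj_mult_far_field_response:
  "cnj (far_field_response kappa xk yk zk phik x y) * far_field_response kappa xk yk zk phik x y = 1"
proof -
  \<comment> \<open>The exponent is \<open>- \<i>\<close> times a real number, so its real part
    vanishes.\<close>
  have "cmod (far_field_response kappa xk yk zk phik x y) = 1"
    unfolding far_field_response_def Let_def norm_exp_eq_Re by simp
  then show ?thesis
    by (metis complex_norm_square mult.commute of_real_1 power_one)
qed

text \<open>The product norm on \<open>real \<times> real\<close> is Euclidean. The sign of
  \<open>R\<close> matters: for \<open>R < 0\<close> the ball is empty, while the surface, defined
  through \<open>R\<^sup>2\<close>, is not.\<close>

lemma circular_surface_eq_cball:
  assumes "R \<ge> 0"
  shows "circular_surface R = cball 0 R"
  using assms
  by (auto simp: circular_surface_def norm_Pair intro: real_le_lsqrt sqrt_le_D)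

theorem mainTheorem2:
  fixes R kappa :: real
    and K k k' :: nat
    and xs ys zs phi :: "nat \<Rightarrow> real"
    and h :: "nat \<Rightarrow> real \<Rightarrow> real \<Rightarrow> complex"
  assumes "R > 0"
    and "kappa > 0"
    and "\<And>i. i \<in> {1..K} \<Longrightarrow> zs i > 0"
    and "\<And>i. i \<in> {1..K} \<Longrightarrow> phi i \<in> {-pi..pi}"
    and "\<And>i x y. i \<in> {1..K} \<Longrightarrow>
      h i x y = far_field_response kappa (xs i) (ys i) (zs i) (phi i) x y"
    and "k \<in> {1..K}"
    and "k' \<in> {1..K}"
    and "k' = k"
  shows "effective_channel (circular_surface R) h k k' = complex_of_real (pi * R\<^sup>2)"
proof -
  let ?S = "circular_surface R"
  have S: "?S = cball 0 R"
    using \<open>R > 0\<close> by (simp add: circular_surface_eq_cball)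
  have "effective_channel ?S h k k' = (LINT p:?S|lborel. 1)"
    unfolding effective_channel_def
    using assms(5)[OF \<open>k \<in> {1..K}\<close>] \<open>k' = k\<close>
    by (simp add: cnj_mult_far_field_response split_def)
  also have "\<dots> = complex_of_real (measure lborel ?S)"
    \<comment> \<open>Finite measure of the disk makes its indicator integrable.\<close>
    unfolding S using emeasure_lborel_cball_finite[of "0 :: real \<times> real" R]
    by (simp add: set_lebesgue_integral_def scaleR_conv_of_real)
  \<comment> \<open>The volume formula for balls, in dimension 2, where the unit ball has volume
    \<open>pi\<close>.\<close>
  also have "measure lborel ?S = pi * R\<^sup>2"
    using \<open>R > 0\<close> by (simp add: S content_cball unit_ball_vol_2 power2_eq_square)
  finally show ?thesis .
qed

end
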